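(* For $n\ge 1$ let $$f_n(x,y,z) := \sum_{\pi\in S_n} x^{{\rm inv}(\pi)}\, y^{{\rm maj}(\pi)}\, z^{{\rm last}(\pi)}.$$ Then $f_1(x,y,z)=1$ and, for every $n\ge 2$, $$(x-z)\,f_n(x,y,z) = (x^{n}y^{n-1} - z^{n})\, f_{n-1}(x,y,1) + x^{n-1}(1-y^{n-1})\, z\, f_{n-1}(x,y,z/x),$$ as an identity of Laurent polynomials in $x,y,z$.
   Context: $S_n$ is the symmetric group on $\{1,\dots,n\}$, permutations written in one-line notation $(\pi(1),\dots,\pi(n))$. ${\rm inv}(\pi)=\#\{(i,j): i<j,\ \pi(i)>\pi(j)\}$ is the inversion number; ${\rm maj}(\pi)=\sum\{\,i : 1\le i\le n-1,\ \pi(i)>\pi(i+1)\,\}$ is the major index; ${\rm last}(\pi):=\pi(n)-1$. *)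

theory Defs
  imports
    "HOL-Combinatorics.Permutations"
    "HOL-Library.Poly_Mapping"
    "HOL-Library.Product_Plus"
begin

definition inv_num :: "nat \<Rightarrow> (nat \<Rightarrow> nat) \<Rightarrow> nat" where
  "inv_num n \<pi> = card {(i, j). i \<in> {1..n} \<and> j \<in> {1..n} \<and> i < j \<and> \<pi> i > \<pi> j}"

definition maj :: "nat \<Rightarrow> (nat \<Rightarrow> nat) \<Rightarrow> nat" where
  "maj n \<pi> = \<Sum>{i. 1 \<le> i \<and> i \<le> n - 1 \<and> \<pi> i > \<pi> (i + 1)}"

definition last_stat :: "nat \<Rightarrow> (nat \<Rightarrow> nat) \<Rightarrow> nat" where
  "last_stat n \<pi> = \<pi> n - 1"

text \<open>The polynomial is a function on an arbitrary commutative ring, so that substitutions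
  such as $z \mapsto 1$ and $z \mapsto z/x$ are plain function application.\<close>

definition f_poly :: "nat \<Rightarrow> 'a::comm_ring_1 \<Rightarrow> 'a \<Rightarrow> 'a \<Rightarrow> 'a" where
  "f_poly n x y z = (\<Sum>\<pi> | \<pi> permutes {1..n}. x ^ inv_num n \<pi> * y ^ maj n \<pi> * z ^ last_stat n \<pi>)"

text \<open>Laurent polynomials in $x,y,z$ over the integers are the group ring of $\mathbb{Z}^3$:
  finitely supported maps from exponent vectors to coefficients, with convolution product.\<close>

type_synonym laurent3 = "(int \<times> int \<times> int) \<Rightarrow>\<^sub>0 int"

definition LX :: laurent3 where "LX = Poly_Mapping.single (1, 0, 0) 1"
definition LX_inv :: laurent3 where "LX_inv = Poly_Mapping.single (-1, 0, 0) 1"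
definition LY :: laurent3 where "LY = Poly_Mapping.single (0, 1, 0) 1"
definition LZ :: laurent3 where "LZ = Poly_Mapping.single (0, 0, 1) 1"

lemma LX_mult_LX_inv: "LX * LX_inv = 1"
  by (simp add: LX_def LX_inv_def mult_single flip: single_one zero_prod_def)

end

theory Submission
  imports Defs
begin

text \<open>Deleting the last entry \<open>k\<close> of a permutation of \<open>{1..m + 1}\<close> and standardising the rest gives
  a permutation \<open>\<sigma>\<close> of \<open>{1..m}\<close>, and the pair \<open>(\<sigma>, k)\<close> is arbitrary. Appending \<open>k\<close> creates
  \<open>m + 1 - k\<close> inversions, and creates a descent at position \<open>m\<close> exactly when \<open>k \<le> \<sigma> m\<close>. For fixed
  \<open>\<sigma>\<close> the sum over \<open>k\<close> therefore splits at \<open>\<sigma> m\<close> into two geometric sums of ratio \<open>z / x\<close>, which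
  telescope after multiplication by \<open>x - z\<close>.\<close>

text \<open>The inverse of delete-and-standardise: entries at least \<open>k\<close> move up by one
  to free the value \<open>k\<close>. The last branch fixes every point outside
  \<open>{1..Suc m}\<close>, as \<open>permutes\<close> demands.\<close>

definition append_value :: "nat \<Rightarrow> (nat \<Rightarrow> nat) \<Rightarrow> nat \<Rightarrow> nat \<Rightarrow> nat" where
  "append_value m \<sigma> k i =
    (if i \<in> {1..m} then (if \<sigma> i < k then \<sigma> i else Suc (\<sigma> i)) else if i = Suc m then k else i)"

lemma append_value_last [simp]: "append_value m \<sigma> k (Suc m) = k"
  by (simp add: append_value_def)

text \<open>The shift of values is strictly increasing, so inversions and descents among the first
  \<open>m\<close> positions survive unchanged.\<close>

lemma append_value_less_iff:
  assumes "i \<in> {1..m}" "j \<in> {1..m}"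
  shows "append_value m \<sigma> k i < append_value m \<sigma> k j \<longleftrightarrow> \<sigma> i < \<sigma> j"
  using assms by (auto simp: append_value_def)

text \<open>An old entry equal to \<open>k\<close> becomes \<open>Suc k\<close>, whence the
  non-strict comparison on the right.\<close>

lemma less_append_value_iff:
  assumes "i \<in> {1..m}"
  shows "k < append_value m \<sigma> k i \<longleftrightarrow> k \<le> \<sigma> i"
  using assms by (auto simp: append_value_def)

lemma append_value_permutes:
  assumes \<sigma>: "\<sigma> permutes {1..m}" and k: "k \<in> {1..Suc m}"
  shows "append_value m \<sigma> k permutes {1..Suc m}"
proof (rule bij_imp_permutes)
  have inj: "inj_on (append_value m \<sigma> k) {1..Suc m}"
  proof (rule inj_onI)
    fix i j
    assume "i \<in> {1..Suc m}" "j \<in> {1..Suc m}" "append_value m \<sigma> k i = append_value m \<sigma> k j"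
    moreover have "i = j" if "\<sigma> i = \<sigma> j"
      using that permutes_inj[OF \<sigma>] by (simp add: inj_eq)
    ultimately show "i = j"
      by (auto simp: append_value_def split: if_splits)
  qed
  have "append_value m \<sigma> k i \<in> {1..Suc m}" if "i \<in> {1..Suc m}" for i
    using that k permutes_in_image[OF \<sigma>, of i] by (auto simp: append_value_def)
  then have "append_value m \<sigma> k ` {1..Suc m} = {1..Suc m}"
    by (intro endo_inj_surj inj) auto
  with inj show "bij_betw (append_value m \<sigma> k) {1..Suc m} {1..Suc m}"
    by (simp add: bij_betw_def)
qed (auto simp: append_value_def)

lemma bij_betw_append_value:
  "bij_betw (\<lambda>(\<sigma>, k). append_value m \<sigma> k)
     ({\<sigma>. \<sigma> permutes {1..m}} \<times> {1..Suc m}) {\<pi>. \<pi> permutes {1..Suc m}}"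
    (is "bij_betw ?F ?A ?B")
proof -
  have inj: "inj_on ?F ?A"
  proof (rule inj_onI, clarsimp)
    fix \<sigma> \<tau> k l
    assume \<sigma>: "\<sigma> permutes {Suc 0..m}" and \<tau>: "\<tau> permutes {Suc 0..m}"
      and eq: "append_value m \<sigma> k = append_value m \<tau> l"
    have "k = l"
      using fun_cong[OF eq, of "Suc m"] by simp
    moreover have "\<sigma> i = \<tau> i" for i
    proof (cases "i \<in> {1..m}")
      case True
      then show ?thesis
        using fun_cong[OF eq, of i] \<open>k = l\<close> by (auto simp: append_value_def split: if_splits)
    next
      case False
      then show ?thesis
        using \<sigma> \<tau> by (simp add: permutes_not_in)
    qed
    ultimately show "\<sigma> = \<tau> \<and> k = l" by blast
  qed
  have "?F ` ?A \<subseteq> ?B"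
    using append_value_permutes by auto
  \<comment> \<open>Surjectivity by counting, \<open>fact m * Suc m = fact (Suc m)\<close>, which
    avoids constructing the deletion map.\<close>
  moreover have "card (?F ` ?A) = card ?B"
    by (subst card_image[OF inj]) (simp add: card_cartesian_product card_permutations)
  ultimately have "?F ` ?A = ?B"
    by (intro card_subset_eq) (auto simp: finite_permutations)
  with inj show ?thesis
    by (simp add: bij_betw_def)
qed

lemma inv_num_append_value:
  assumes \<sigma>: "\<sigma> permutes {1..m}" and k: "k \<in> {1..Suc m}"
  shows "inv_num (Suc m) (append_value m \<sigma> k) = inv_num m \<sigma> + (Suc m - k)"
proof -
  let ?\<pi> = "append_value m \<sigma> k"
  let ?I = "{(i, j). i \<in> {1..m} \<and> j \<in> {1..m} \<and> i < j \<and> \<sigma> i > \<sigma> j}"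
  let ?K = "{i \<in> {1..m}. k \<le> \<sigma> i}"
  have split: "{(i, j). i \<in> {1..Suc m} \<and> j \<in> {1..Suc m} \<and> i < j \<and> ?\<pi> i > ?\<pi> j}
      = ?I \<union> ?K \<times> {Suc m}" (is "?L = ?R")
  proof -
    have "(i, j) \<in> ?L \<longleftrightarrow> (i, j) \<in> ?R" for i j
    proof (cases "j = Suc m")
      case True
      then show ?thesis
        using less_append_value_iff[of i m k \<sigma>] by auto
    next
      case False
      then show ?thesis
        using append_value_less_iff[of j m i \<sigma> k] by auto
    qed
    then show ?thesis by auto
  qed
  \<comment> \<open>New inversions are counted by value rather than position: \<sigma> takes each
    value in \<open>{k..m}\<close> exactly once. For \<open>k = Suc m\<close> the interval is
    empty.\<close>
  have "\<sigma> ` ?K = {k..m}"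
  proof -
    have "\<sigma> ` ?K = \<sigma> ` {1..m} \<inter> {k..}" by auto
    then show ?thesis
      using k by (auto simp: permutes_image[OF \<sigma>, simplified])
  qed
  moreover have "inj_on \<sigma> ?K"
    using permutes_inj[OF \<sigma>] by (rule inj_on_subset) simp
  ultimately have "card ?K = Suc m - k"
    by (metis card_image card_atLeastAtMost)
  moreover have "finite ?I"
    by (rule finite_subset[of _ "{1..m} \<times> {1..m}"]) auto
  ultimately show ?thesis
    unfolding inv_num_def split
    by (subst card_Un_disjoint) (auto simp: card_cartesian_product)
qed

lemma maj_append_value:
  assumes "1 \<le> m"
  shows "maj (Suc m) (append_value m \<sigma> k) = maj m \<sigma> + (if k \<le> \<sigma> m then m else 0)"
proof -
  let ?\<pi> = "append_value m \<sigma> k"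
  let ?D = "{i. 1 \<le> i \<and> i \<le> m - 1 \<and> \<sigma> i > \<sigma> (i + 1)}"
  have split: "{i. 1 \<le> i \<and> i \<le> Suc m - 1 \<and> ?\<pi> i > ?\<pi> (i + 1)} = ?D \<union> (if k \<le> \<sigma> m then {m} else {})"
    (is "?L = ?R")
  proof -
    have "i \<in> ?L \<longleftrightarrow> i \<in> ?R" for i
    proof (cases "i = m")
      case True
      then show ?thesis
        using less_append_value_iff[of m m k \<sigma>] assms by auto
    next
      case False
      then show ?thesis
        using append_value_less_iff[of "i + 1" m i \<sigma> k] by auto
    qed
    then show ?thesis by blast
  qed
  have "finite ?D" "m \<notin> ?D"
    using assms by auto
  then have "\<Sum>(insert m ?D) = m + \<Sum>?D"
    by (rule sum.insert)
  then show ?thesis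
    unfolding maj_def split by simp
qed

text \<open>Multiplied by \<open>x - z\<close>, the \<open>k\<close>-th term becomes
  \<open>x ^ (n - (k - 1)) * z ^ (k - 1) - x ^ (n - k) * z ^ k\<close>. This form needs no
  division.\<close>

lemma telescoping_geometric_sum:
  fixes x z :: "'a::comm_ring_1"
  assumes "a \<le> b" "b \<le> n"
  shows "(x - z) * (\<Sum>k = Suc a..b. x ^ (n - k) * z ^ (k - 1)) =
    x ^ (n - a) * z ^ a - x ^ (n - b) * z ^ b"
  using assms
proof (induction rule: dec_induct)
  case (step b)
  \<comment> \<open>Since \<open>Suc b \<le> n\<close>, the subtraction is not truncated.\<close>
  then have "n - b = Suc (n - Suc b)" by simp
  with step show ?case
    by (simp add: algebra_simps)
qed simp

text \<open>Here \<open>u\<close> stands for 1/x and \<open>j\<close> for the last entry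
  \<open>\<sigma> m\<close>. The two telescoped pieces share the boundary term
  \<open>x ^ (Suc m - j) * z ^ j\<close>, which survives with coefficient \<open>1 - y ^ m\<close>
  and is then rewritten as a power of z/x.\<close>

lemma append_value_weight_sum:
  fixes x u y z :: "'a::comm_ring_1"
  assumes xu: "x * u = 1" and j: "j \<in> {1..m}"
  shows "(x - z) * (\<Sum>k = 1..Suc m. x ^ (Suc m - k) * y ^ (if k \<le> j then m else 0) * z ^ (k - 1)) =
    x ^ Suc m * y ^ m - z ^ Suc m + x ^ m * (1 - y ^ m) * z * (z * u) ^ (j - 1)"
proof -
  let ?t = "\<lambda>k. x ^ (Suc m - k) * z ^ (k - 1)"
  let ?g = "\<lambda>k. x ^ (Suc m - k) * y ^ (if k \<le> j then m else 0) * z ^ (k - 1)"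
  have "{1..Suc m} = {Suc 0..j} \<union> {Suc j..Suc m}"
    using j by auto
  then have "sum ?g {1..Suc m} = sum ?g {Suc 0..j} + sum ?g {Suc j..Suc m}"
    by (simp only:) (intro sum.union_disjoint; auto)
  also have "sum ?g {Suc 0..j} = y ^ m * sum ?t {Suc 0..j}"
    unfolding sum_distrib_left by (intro sum.cong) (auto simp: algebra_simps)
  also have "sum ?g {Suc j..Suc m} = sum ?t {Suc j..Suc m}"
    by (intro sum.cong) auto
  finally have "(x - z) * sum ?g {1..Suc m} =
      y ^ m * ((x - z) * sum ?t {Suc 0..j}) + (x - z) * sum ?t {Suc j..Suc m}"
    by (simp only: algebra_simps)
  also have "\<dots> = y ^ m * (x ^ Suc m - x ^ (Suc m - j) * z ^ j) + (x ^ (Suc m - j) * z ^ j - z ^ Suc m)"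
    using telescoping_geometric_sum[of 0 j "Suc m" x z]
      telescoping_geometric_sum[of j "Suc m" "Suc m" x z] j by simp
  also have "\<dots> = x ^ Suc m * y ^ m - z ^ Suc m + (1 - y ^ m) * (x ^ (Suc m - j) * z ^ j)"
    by (simp only: algebra_simps mult_1_left)
  \<comment> \<open>The only use of invertibility of \<open>x\<close>: the two sides differ by the
    factor \<open>(x * u) ^ (j - 1)\<close>.\<close>
  also have "x ^ (Suc m - j) * z ^ j = x ^ m * z * (z * u) ^ (j - 1)"
  proof -
    obtain i d where "j = Suc i" "m = d + i"
      using j by (metis One_nat_def Suc_le_D atLeastAtMost_iff le_add_diff_inverse2 Suc_leD)
    then have "x ^ m * z * (z * u) ^ (j - 1) = x ^ (Suc m - j) * z ^ j * (x * u) ^ i"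
      by (simp add: power_add power_mult_distrib mult_ac)
    then show ?thesis by (simp add: xu)
  qed
  finally show ?thesis
    by (simp only: mult_ac)
qed

text \<open>Along the bijection the weight factors, and the inner sum over \<open>k\<close> depends
  on \<sigma> only through \<open>\<sigma> m\<close>.\<close>

lemma f_poly_Suc:
  fixes x y z :: "'a::comm_ring_1"
  assumes "1 \<le> m"
  shows "f_poly (Suc m) x y z = (\<Sum>\<sigma> | \<sigma> permutes {1..m}. x ^ inv_num m \<sigma> * y ^ maj m \<sigma> *
    (\<Sum>k = 1..Suc m. x ^ (Suc m - k) * y ^ (if k \<le> \<sigma> m then m else 0) * z ^ (k - 1)))"
proof -
  let ?w = "\<lambda>\<pi>. x ^ inv_num (Suc m) \<pi> * y ^ maj (Suc m) \<pi> * z ^ last_stat (Suc m) \<pi>"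
  have "f_poly (Suc m) x y z =
      (\<Sum>p \<in> {\<sigma>. \<sigma> permutes {1..m}} \<times> {1..Suc m}. ?w (case p of (\<sigma>, k) \<Rightarrow> append_value m \<sigma> k))"
    unfolding f_poly_def by (rule sum.reindex_bij_betw[OF bij_betw_append_value, symmetric])
  also have "\<dots> = (\<Sum>\<sigma> | \<sigma> permutes {1..m}. \<Sum>k = 1..Suc m. ?w (append_value m \<sigma> k))"
    by (subst sum.cartesian_product) (auto intro!: sum.cong)
  also have "\<dots> = (\<Sum>\<sigma> | \<sigma> permutes {1..m}. x ^ inv_num m \<sigma> * y ^ maj m \<sigma> *
      (\<Sum>k = 1..Suc m. x ^ (Suc m - k) * y ^ (if k \<le> \<sigma> m then m else 0) * z ^ (k - 1)))"
    unfolding sum_distrib_left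
  proof (intro sum.cong refl)
    fix \<sigma> k
    assume "\<sigma> \<in> {\<sigma>. \<sigma> permutes {1..m}}" "k \<in> {1..Suc m}"
    then have "inv_num (Suc m) (append_value m \<sigma> k) = inv_num m \<sigma> + (Suc m - k)"
      by (simp add: inv_num_append_value)
    moreover have "last_stat (Suc m) (append_value m \<sigma> k) = k - 1"
      by (simp add: last_stat_def)
    ultimately show "?w (append_value m \<sigma> k) = x ^ inv_num m \<sigma> * y ^ maj m \<sigma> *
        (x ^ (Suc m - k) * y ^ (if k \<le> \<sigma> m then m else 0) * z ^ (k - 1))"
      by (simp only: maj_append_value[OF assms] power_add mult_ac)
  qed
  finally show ?thesis .
qed

text \<open>In the evaluated inner sum, the part free of \<sigma> collects to
  \<open>f_poly m x y 1\<close>. The exponent \<open>\<sigma> m - 1\<close> in the other part is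
  \<open>last_stat m \<sigma>\<close>, which produces the substitution of z/x for z.\<close>

lemma f_poly_recurrence:
  fixes x u y z :: "'a::comm_ring_1"
  assumes xu: "x * u = 1" and m: "1 \<le> m"
  shows "(x - z) * f_poly (Suc m) x y z =
    (x ^ Suc m * y ^ m - z ^ Suc m) * f_poly m x y 1
    + x ^ m * (1 - y ^ m) * z * f_poly m x y (z * u)"
proof -
  let ?c = "\<lambda>\<sigma>. x ^ inv_num m \<sigma> * y ^ maj m \<sigma>"
  have "(x - z) * f_poly (Suc m) x y z = (\<Sum>\<sigma> | \<sigma> permutes {1..m}. ?c \<sigma> *
      ((x - z) * (\<Sum>k = 1..Suc m. x ^ (Suc m - k) * y ^ (if k \<le> \<sigma> m then m else 0) * z ^ (k - 1))))"
    unfolding f_poly_Suc[OF m] sum_distrib_left[of "x - z" _ "{\<sigma>. \<sigma> permutes {1..m}}"]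
    by (simp only: mult.left_commute)
  also have "\<dots> = (\<Sum>\<sigma> | \<sigma> permutes {1..m}. ?c \<sigma> * (x ^ Suc m * y ^ m - z ^ Suc m
      + x ^ m * (1 - y ^ m) * z * (z * u) ^ (\<sigma> m - 1)))"
  proof (intro sum.cong refl arg_cong2[where f = times] append_value_weight_sum[OF xu])
    fix \<sigma>
    assume "\<sigma> \<in> {\<sigma>. \<sigma> permutes {1..m}}"
    then show "\<sigma> m \<in> {1..m}"
      using m by (simp add: permutes_in_image del: atLeastAtMost_iff) simp
  qed
  also have "\<dots> = (x ^ Suc m * y ^ m - z ^ Suc m) * f_poly m x y 1
      + x ^ m * (1 - y ^ m) * z * f_poly m x y (z * u)"
    unfolding f_poly_def last_stat_def sum_distrib_left sum.distrib[symmetric]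
    by (simp only: distrib_left mult_ac power_one mult_1_right mult_1_left)
  finally show ?thesis .
qed

lemma f_poly_1: "f_poly 1 x y z = 1"
proof -
  \<comment> \<open>The identity is the only permutation of a one-point set.\<close>
  have "inv_num 1 id = 0" "maj 1 id = 0" "last_stat 1 id = 0"
    by (auto simp: inv_num_def maj_def last_stat_def card_eq_0_iff)
  then show ?thesis
    by (simp add: f_poly_def)
qed

theorem theorem2p1:
  shows "f_poly 1 LX LY LZ = 1 \<and>
    (\<forall>n\<ge>2. (LX - LZ) * f_poly n LX LY LZ =
        (LX ^ n * LY ^ (n - 1) - LZ ^ n) * f_poly (n - 1) LX LY 1
        + LX ^ (n - 1) * (1 - LY ^ (n - 1)) * LZ * f_poly (n - 1) LX LY (LZ * LX_inv))"
proof (intro conjI allI impI)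
  show "f_poly 1 LX LY LZ = 1" by (rule f_poly_1)
next
  fix n :: nat
  assume "2 \<le> n"
  then obtain m where n: "n = Suc m" and "1 \<le> m"
    by (cases n) auto
  then show "(LX - LZ) * f_poly n LX LY LZ =
        (LX ^ n * LY ^ (n - 1) - LZ ^ n) * f_poly (n - 1) LX LY 1
        + LX ^ (n - 1) * (1 - LY ^ (n - 1)) * LZ * f_poly (n - 1) LX LY (LZ * LX_inv)"
    unfolding n diff_Suc_1 by (intro f_poly_recurrence LX_mult_LX_inv)
qed

end
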